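(* Let $k,n$ be positive integers. There exists a $C^k$ integrable almost complex structure $J$ on $\mathbb{R}^{2n}$ such that there is no $C^{k,1}$ complex coordinate chart $w=(w^1,\dots,w^n):U\subset\mathbb{R}^{2n}\to\mathbb{C}^n$, defined on a neighborhood $U$ of $0$, satisfying $J\frac{\partial}{\partial w^j}=i\frac{\partial}{\partial w^j}$ for $j=1,\dots,n$.
   Context: An almost complex structure is a bundle endomorphism $J:T\mathbb{R}^{2n}\to T\mathbb{R}^{2n}$ with $J^2=-\mathrm{id}$; it is $C^k$ if its coefficients are $C^k$ functions. $J$ is integrable if its Nijenhuis tensor $N_J(X,Y)=[JX,JY]-J[JX,Y]-J[X,JY]-[X,Y]$ vanishes; equivalently, the $i$-eigenbundle $\{v\in\mathbb{C}T_p\mathbb{R}^{2n}: J_pv=iv\}$ is closed under Lie brackets of complex vector fields. $C^{k,1}$ denotes functions whose derivatives up to order $k$ exist and the $k$-th derivatives are Lipschitz. *)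

theory Defs
  imports "HOL-Analysis.Analysis"
begin

fun Ck :: "nat \<Rightarrow> ('a::euclidean_space \<Rightarrow> 'b::real_normed_vector) \<Rightarrow> 'a set \<Rightarrow> bool" where
  "Ck 0 f S = continuous_on S f"
| "Ck (Suc k) f S = ((\<forall>x\<in>S. f differentiable (at x)) \<and>
      (\<forall>i\<in>Basis. Ck k (\<lambda>x. frechet_derivative f (at x) i) S))"

fun CkLip :: "nat \<Rightarrow> ('a::euclidean_space \<Rightarrow> 'b::real_normed_vector) \<Rightarrow> 'a set \<Rightarrow> bool" where
  "CkLip 0 f S = (\<exists>L. L-lipschitz_on S f)"
| "CkLip (Suc k) f S = ((\<forall>x\<in>S. f differentiable (at x)) \<and>
      (\<forall>i\<in>Basis. CkLip k (\<lambda>x. frechet_derivative f (at x) i) S))"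

definition almost_complex :: "(real^'m \<Rightarrow> real^'m^'m) \<Rightarrow> bool" where
  "almost_complex J \<longleftrightarrow> (\<forall>p. J p ** J p = - mat 1)"

definition Ck_structure :: "nat \<Rightarrow> (real^'m \<Rightarrow> real^'m^'m) \<Rightarrow> bool" where
  "Ck_structure k J \<longleftrightarrow> (\<forall>i j. Ck k (\<lambda>p. J p $ i $ j) UNIV)"

definition lie_bracket :: "(real^'m \<Rightarrow> real^'m) \<Rightarrow> (real^'m \<Rightarrow> real^'m) \<Rightarrow> real^'m \<Rightarrow> real^'m" where
  "lie_bracket X Y p = frechet_derivative Y (at p) (X p) - frechet_derivative X (at p) (Y p)"

definition applyJ :: "(real^'m \<Rightarrow> real^'m^'m) \<Rightarrow> (real^'m \<Rightarrow> real^'m) \<Rightarrow> real^'m \<Rightarrow> real^'m" where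
  "applyJ J X = (\<lambda>p. J p *v X p)"

definition nijenhuis ::
  "(real^'m \<Rightarrow> real^'m^'m) \<Rightarrow> (real^'m \<Rightarrow> real^'m) \<Rightarrow> (real^'m \<Rightarrow> real^'m) \<Rightarrow> real^'m \<Rightarrow> real^'m" where
  "nijenhuis J X Y p =
     lie_bracket (applyJ J X) (applyJ J Y) p
     - J p *v lie_bracket (applyJ J X) Y p
     - J p *v lie_bracket X (applyJ J Y) p
     - lie_bracket X Y p"

definition integrable_acs :: "(real^'m \<Rightarrow> real^'m^'m) \<Rightarrow> bool" where
  "integrable_acs J \<longleftrightarrow>
     (\<forall>X Y. (\<forall>p. X differentiable (at p)) \<and> (\<forall>p. Y differentiable (at p)) \<longrightarrow>
        (\<forall>p. nijenhuis J X Y p = 0))"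

definition cx_apply :: "real^'m^'m \<Rightarrow> complex^'m \<Rightarrow> complex^'m" where
  "cx_apply A v = (\<chi> l. Complex ((A *v (\<chi> j. Re (v $ j))) $ l) ((A *v (\<chi> j. Im (v $ j))) $ l))"

text \<open>Coordinate vector d/dw^j = (d/dx^j - i d/dy^j)/2 of the chart w at p, where w^j = x^j + i y^j;
  d/dx^j and d/dy^j are the preimages of the real basis vectors e_j, i e_j of C^n
  under the (real) differential of w at p.\<close>
definition coord_dw :: "(real^'m \<Rightarrow> complex^'n) \<Rightarrow> real^'m \<Rightarrow> 'n \<Rightarrow> complex^'m" where
  "coord_dw w p j =
     (let Dinv = inv (frechet_derivative w (at p));
          dx = Dinv (axis j 1);
          dy = Dinv (axis j \<i>)
      in (\<chi> l. (complex_of_real (dx $ l) - \<i> * complex_of_real (dy $ l)) / 2))"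

definition coord_chart :: "(real^'m \<Rightarrow> complex^'n) \<Rightarrow> (real^'m) set \<Rightarrow> bool" where
  "coord_chart w U \<longleftrightarrow> open U \<and> inj_on w U \<and> open (w ` U) \<and>
     (\<forall>p\<in>U. w differentiable (at p) \<and> bij (frechet_derivative w (at p)))"

end

theory Submission
  imports Defs
begin

text \<open>
  On each coordinate plane take \<open>J\<close> to be the matrix with rows \<open>(a, -(1 + a^2))\<close> and \<open>(1, -a)\<close>, where
  \<open>a = x^(k+2) g(ln (r^2)) / r^2\<close> and \<open>g(t) = -t / (1 + t^2)\<close>. All derivatives of \<open>g\<close> vanish at
  \<open>-\<infinity>\<close>, so \<open>a\<close> is of class \<open>C^k\<close>; integrability is automatic for a product of planar structures.
  Every component \<open>f\<close> of a holomorphic chart satisfies \<open>f_y = (\<i> - a) f_x\<close> in such a plane.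
  Let \<open>G(r)\<close> be the \<open>(k+1)\<close>-st Fourier coefficient of \<open>f\<close> on the circle of radius \<open>r\<close>. If \<open>f\<close> is
  \<open>C^{k,1}\<close>, then \<open>G = O(r^(k+1))\<close>, since the Taylor polynomial of degree \<open>k\<close> does not contribute.
  On the other hand the equation gives \<open>(G / r^(k+1))' = -\<i> (g(ln (r^2)) / r) (c f_x(0) + o(1))\<close> with
  \<open>c = 2 \<pi> / 2^(k+2)\<close>, and the integral of \<open>g(ln (r^2)) / r\<close> diverges at \<open>0\<close> (like \<open>ln (ln (1/r))\<close>).
  Hence \<open>f_x(0) = 0\<close> for every component, contradicting the invertibility of the differential.
\<close>

subsection \<open>Functions of class \<open>C^k\<close>\<close>

lemma Ck_Suc_imp: "Ck (Suc k) f S \<Longrightarrow> Ck k f S"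
proof (induction k arbitrary: f)
  case 0
  then show ?case
    by (auto intro!: continuous_at_imp_continuous_on differentiable_imp_continuous_within)
next
  case (Suc k)
  then show ?case by (metis Ck.simps(2))
qed

lemma Ck_const: "Ck k (\<lambda>x. c) UNIV"
  by (induction k arbitrary: c) simp_all

lemma Ck_add:
  assumes "Ck k f UNIV" and "Ck k g UNIV"
  shows "Ck k (\<lambda>x. f x + g x) UNIV"
  using assms
proof (induction k arbitrary: f g)
  case 0
  then show ?case by (auto intro: continuous_intros)
next
  case (Suc k)
  have D: "f differentiable (at x)" "g differentiable (at x)" for x
    using Suc.prems by auto
  have "frechet_derivative (\<lambda>x. f x + g x) (at x) i
      = frechet_derivative f (at x) i + frechet_derivative g (at x) i" for x i
    using frechet_derivative_at[OF has_derivative_add[OF D[THEN frechet_derivative_works[THEN iffD1]]]]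
    by (metis (mono_tags, lifting))
  with Suc show ?case by (simp add: differentiable_add)
qed

lemma Ck_mult:
  fixes f g :: "'a::euclidean_space \<Rightarrow> real"
  assumes "Ck k f UNIV" and "Ck k g UNIV"
  shows "Ck k (\<lambda>x. f x * g x) UNIV"
  using assms
proof (induction k arbitrary: f g)
  case 0
  then show ?case by (auto intro: continuous_intros)
next
  case (Suc k)
  have D: "f differentiable (at x)" "g differentiable (at x)" for x
    using Suc.prems by auto
  have eq: "(\<lambda>x. f x * frechet_derivative g (at x) i + frechet_derivative f (at x) i * g x)
      = (\<lambda>x. frechet_derivative (\<lambda>x. f x * g x) (at x) i)" for i
    using frechet_derivative_at[OF has_derivative_mult[OF D[THEN frechet_derivative_works[THEN iffD1]]]]
    by (metis (mono_tags, lifting))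
  have "Ck k (\<lambda>x. f x * frechet_derivative g (at x) i + frechet_derivative f (at x) i * g x) UNIV"
    if "i \<in> Basis" for i
    using Suc.prems that by (intro Ck_add Suc.IH Suc.prems[THEN Ck_Suc_imp]) auto
  then show ?case using D by (simp add: eq)
qed

locale mono_log =
  fixes g :: "nat \<Rightarrow> real \<Rightarrow> real" and \<alpha> \<beta> :: "'m::finite"
  assumes g_deriv: "(g j has_real_derivative g (Suc j) t) (at t)"
    and g_lim: "(g j \<longlongrightarrow> 0) at_bot"
    and \<alpha>\<beta>: "\<alpha> \<noteq> \<beta>"
begin

definition sq :: "real^'m \<Rightarrow> real" where
  "sq p = (p $ \<alpha>)\<^sup>2 + (p $ \<beta>)\<^sup>2"

definition term_fun :: "nat \<Rightarrow> nat \<Rightarrow> nat \<Rightarrow> nat \<Rightarrow> real^'m \<Rightarrow> real" where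
  "term_fun a b e j p = (p $ \<alpha>) ^ a * (p $ \<beta>) ^ b * g j (ln (sq p)) / sq p ^ Suc e"

definition size_fun :: "nat \<Rightarrow> real^'m \<Rightarrow> real" where
  "size_fun j p = (if sq p = 0 then 0 else g j (ln (sq p)))"

lemma sq_nonneg: "sq p \<ge> 0"
  by (simp add: sq_def)

lemma has_derivative_sq:
  "(sq has_derivative (\<lambda>h. 2 * (p $ \<alpha>) * (h $ \<alpha>) + 2 * (p $ \<beta>) * (h $ \<beta>))) (at p)"
  unfolding sq_def[abs_def] power2_eq_square
  by (auto intro!: derivative_eq_intros bounded_linear.has_derivative[OF bounded_linear_vec_nth])

lemma isCont_sq: "isCont sq p"
  using has_derivative_sq has_derivative_continuous by blast

lemma size_fun_tendsto:
  assumes "sq p = 0"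
  shows "(size_fun j \<longlongrightarrow> 0) (at p)"
proof (rule tendstoI)
  fix e :: real assume "e > 0"
  obtain T where T: "\<And>t. t \<le> T \<Longrightarrow> \<bar>g j t\<bar> < e"
    using tendstoD[OF g_lim \<open>e > 0\<close>] by (auto simp: eventually_at_bot_linorder)
  have "eventually (\<lambda>q. sq q < exp T) (at p)"
    using isCont_sq[of p] assms unfolding isCont_def by (auto intro!: order_tendstoD(2))
  then show "eventually (\<lambda>q. dist (size_fun j q) 0 < e) (at p)"
  proof (rule eventually_mono)
    fix q assume q: "sq q < exp T"
    have "\<bar>g j (ln (sq q))\<bar> < e" if "sq q \<noteq> 0"
    proof (rule T)
      have "sq q > 0" using that sq_nonneg[of q] by simp
      with q show "ln (sq q) \<le> T" by (metis less_imp_le ln_exp ln_less_cancel_iff exp_gt_zero)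
    qed
    then show "dist (size_fun j q) 0 < e"
      using \<open>e > 0\<close> by (simp add: size_fun_def)
  qed
qed

lemma term_fun_bound:
  assumes "a + b = k + 2 * Suc e"
  shows "\<bar>term_fun a b e j p\<bar> \<le> sqrt (sq p) ^ k * \<bar>size_fun j p\<bar>"
proof (cases "sq p = 0")
  case False
  define r where "r = sqrt (sq p)"
  have r: "r > 0" "sq p = r\<^sup>2"
    using False sq_nonneg[of p] by (auto simp: r_def)
  have "\<bar>p $ \<alpha>\<bar> ^ a \<le> r ^ a" "\<bar>p $ \<beta>\<bar> ^ b \<le> r ^ b"
    unfolding r_def sq_def by (auto intro!: power_mono real_le_rsqrt)
  then have "\<bar>p $ \<alpha>\<bar> ^ a * \<bar>p $ \<beta>\<bar> ^ b \<le> r ^ (a + b)"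
    unfolding power_add using r by (intro mult_mono) auto
  also have "\<dots> = r ^ k * sq p ^ Suc e"
    using r assms by (metis power_add power_mult)
  finally have *: "\<bar>p $ \<alpha>\<bar> ^ a * \<bar>p $ \<beta>\<bar> ^ b \<le> r ^ k * sq p ^ Suc e" .
  have pos: "sq p ^ Suc e > 0" using r by auto
  have "\<bar>term_fun a b e j p\<bar> = \<bar>p $ \<alpha>\<bar> ^ a * \<bar>p $ \<beta>\<bar> ^ b / sq p ^ Suc e * \<bar>size_fun j p\<bar>"
    using False sq_nonneg[of p] by (simp add: term_fun_def size_fun_def abs_mult power_abs)
  also have "\<dots> \<le> r ^ k * \<bar>size_fun j p\<bar>"
    using * pos by (intro mult_right_mono) (auto simp: field_simps)
  finally show ?thesis by (simp add: r_def)
qed (simp add: term_fun_def)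

lemma term_fun_0: "sq p = 0 \<Longrightarrow> term_fun a b e j p = 0"
  by (simp add: term_fun_def)

lemma has_derivative_term_fun_nz:
  assumes "sq p \<noteq> 0"
  shows "(term_fun a b e j has_derivative
     (\<lambda>h. h $ \<alpha> * (real a * term_fun (a - 1) b e j p
              + 2 * term_fun (Suc a) b (Suc e) (Suc j) p
              + - 2 * real (Suc e) * term_fun (Suc a) b (Suc e) j p)
        + h $ \<beta> * (real b * term_fun a (b - 1) e j p
              + 2 * term_fun a (Suc b) (Suc e) (Suc j) p
              + - 2 * real (Suc e) * term_fun a (Suc b) (Suc e) j p))) (at p)"
proof -
  have pos: "sq p > 0" using assms sq_nonneg[of p] by simp
  have 1: "((\<lambda>p. g j (ln (sq p))) has_derivative
     (\<lambda>h. g (Suc j) (ln (sq p)) * ((2 * (p $ \<alpha>) * (h $ \<alpha>) + 2 * (p $ \<beta>) * (h $ \<beta>)) / sq p))) (at p)"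
  proof (rule has_derivative_eq_rhs)
    show "((\<lambda>p. g j (ln (sq p))) has_derivative (\<lambda>h. (2 * (p $ \<alpha>) * (h $ \<alpha>) + 2 * (p $ \<beta>) * (h $ \<beta>))
        * inverse (sq p) * g (Suc j) (ln (sq p)))) (at p)"
      using pos by (intro DERIV_compose_FDERIV[OF g_deriv]
          DERIV_compose_FDERIV[OF DERIV_ln has_derivative_sq]) auto
  qed (simp add: divide_inverse mult_ac)
  have 2: "((\<lambda>p. p $ i) has_derivative (\<lambda>h. h $ i)) (at p)" for i
    by (rule bounded_linear.has_derivative[OF bounded_linear_vec_nth has_derivative_ident])
  have e: "sq p ^ e \<noteq> 0" using pos by simp
  show ?thesis
    unfolding term_fun_def[abs_def]
    apply (rule derivative_eq_intros 1 2 has_derivative_sq refl)+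
    using pos apply simp
    apply (rule ext)
    using pos e apply (simp add: divide_simps)
    by algebra
qed

lemma has_derivative_term_fun_0:
  assumes "sq p = 0" and "a + b = Suc k + 2 * Suc e"
  shows "(term_fun a b e j has_derivative (\<lambda>h. 0)) (at p)"
proof (rule has_derivativeI_sandwich[of 1 _ _ _ _ "\<lambda>q. \<bar>size_fun j q\<bar>"])
  fix q assume q: "q \<noteq> p" "dist q p < 1"
  have p: "p $ \<alpha> = 0" "p $ \<beta> = 0"
    using assms(1) by (auto simp: sq_def sum_power2_eq_zero_iff)
  have "sq q = (\<Sum>i\<in>{\<alpha>, \<beta>}. ((q - p) $ i)\<^sup>2)"
    using \<alpha>\<beta> p by (simp add: sq_def)
  also have "\<dots> \<le> (\<Sum>i\<in>UNIV. ((q - p) $ i)\<^sup>2)"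
    by (rule sum_mono2) auto
  finally have le: "sqrt (sq q) \<le> norm (q - p)"
    by (simp add: norm_vec_def L2_set_def)
  have "\<bar>term_fun a b e j q\<bar> \<le> sqrt (sq q) ^ Suc k * \<bar>size_fun j q\<bar>"
    by (rule term_fun_bound) (use assms in auto)
  also have "\<dots> \<le> (norm (q - p) * 1) * \<bar>size_fun j q\<bar>"
  proof (intro mult_right_mono)
    have "sqrt (sq q) ^ k \<le> 1"
      using le q(2) sq_nonneg[of q] by (intro power_le_one) (simp_all add: dist_norm del: real_sqrt_le_1_iff)
    then show "sqrt (sq q) ^ Suc k \<le> norm (q - p) * 1"
      unfolding power_Suc using le sq_nonneg[of q] by (intro mult_mono) auto
  qed auto
  finally show "norm (term_fun a b e j q - term_fun a b e j p - 0) / norm (q - p) \<le> \<bar>size_fun j q\<bar>"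
    using q assms by (simp add: term_fun_0 field_simps)
next
  show "((\<lambda>q. \<bar>size_fun j q\<bar>) \<longlongrightarrow> 0) (at p)"
    using size_fun_tendsto[OF assms(1)] by (simp add: tendsto_rabs_zero_iff)
qed auto

text \<open>Where \<open>sq p = 0\<close>, all terms on the right are \<open>0\<close> because division by zero yields zero.\<close>
lemma has_derivative_term_fun:
  assumes "a + b = Suc k + 2 * Suc e"
  shows "(term_fun a b e j has_derivative
     (\<lambda>h. h $ \<alpha> * (real a * term_fun (a - 1) b e j p
              + 2 * term_fun (Suc a) b (Suc e) (Suc j) p
              + - 2 * real (Suc e) * term_fun (Suc a) b (Suc e) j p)
        + h $ \<beta> * (real b * term_fun a (b - 1) e j p
              + 2 * term_fun a (Suc b) (Suc e) (Suc j) p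
              + - 2 * real (Suc e) * term_fun a (Suc b) (Suc e) j p))) (at p)"
proof (cases "sq p = 0")
  case True
  then show ?thesis using has_derivative_term_fun_0[OF True assms] by (simp add: term_fun_0)
qed (rule has_derivative_term_fun_nz)

lemma continuous_term_fun:
  assumes "a + b = 2 * Suc e"
  shows "continuous_on UNIV (term_fun a b e j)"
proof (rule continuous_at_imp_continuous_on, rule ballI)
  fix p
  show "isCont (term_fun a b e j) p"
  proof (cases "sq p = 0")
    case True
    have "((\<lambda>q. \<bar>size_fun j q\<bar>) \<longlongrightarrow> 0) (at p)"
      using size_fun_tendsto[OF True] by (simp add: tendsto_rabs_zero_iff)
    then have "(term_fun a b e j \<longlongrightarrow> 0) (at p)"
      by (rule Lim_null_comparison[rotated]) (use term_fun_bound[of a b 0 e] assms in auto)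
    then show ?thesis by (simp add: isCont_def term_fun_0 True)
  next
    case False
    then show ?thesis by (rule has_derivative_continuous[OF has_derivative_term_fun_nz])
  qed
qed

lemma Ck_term_fun:
  assumes "a + b = k + 2 * Suc e"
  shows "Ck k (term_fun a b e j) UNIV"
  using assms
proof (induction k arbitrary: a b e j)
  case 0
  then show ?case using continuous_term_fun by simp
next
  case (Suc k)
  note D = has_derivative_term_fun[OF Suc.prems]
  have A: "Ck k (\<lambda>p. real a * term_fun (a - 1) b e j p) UNIV"
  proof (cases a)
    case (Suc a')
    show ?thesis by (intro Ck_mult Ck_const Suc.IH) (use Suc Suc.prems in auto)
  qed (simp add: Ck_const)
  have B: "Ck k (\<lambda>p. real b * term_fun a (b - 1) e j p) UNIV"
  proof (cases b)
    case (Suc b')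
    show ?thesis by (intro Ck_mult Ck_const Suc.IH) (use Suc Suc.prems in auto)
  qed (simp add: Ck_const)
  have C: "Ck k (\<lambda>p. c * term_fun (Suc a) b (Suc e) j' p) UNIV" for c j'
    by (intro Ck_mult[OF Ck_const] Suc.IH) (use Suc.prems in auto)
  have C': "Ck k (\<lambda>p. c * term_fun a (Suc b) (Suc e) j' p) UNIV" for c j'
    by (intro Ck_mult[OF Ck_const] Suc.IH) (use Suc.prems in auto)
  have "Ck k (\<lambda>p. frechet_derivative (term_fun a b e j) (at p) i) UNIV" for i
    unfolding frechet_derivative_at[OF D, symmetric]
    by (rule Ck_add[OF Ck_mult[OF Ck_const Ck_add[OF Ck_add[OF A C] C]]
          Ck_mult[OF Ck_const Ck_add[OF Ck_add[OF B C'] C']]])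
  then show ?case using D by (auto simp: differentiable_def)
qed

end

subsection \<open>Products of planar almost complex structures\<close>

lemma has_derivative_vecI:
  fixes f :: "'a::real_normed_vector \<Rightarrow> real^'m"
  assumes "\<And>i. ((\<lambda>x. f x $ i) has_derivative (\<lambda>h. f' h $ i)) (at a within T)"
  shows "(f has_derivative f') (at a within T)"
  unfolding has_derivative_componentwise_within[of f f']
  using assms by (auto simp: Basis_vec_def inner_axis)

locale block_structure =
  fixes \<tau> :: "'m::finite \<Rightarrow> 'm" and S :: "'m set" and A :: "'m \<Rightarrow> real^'m \<Rightarrow> real"
  assumes \<tau>\<tau> [simp]: "\<tau> (\<tau> i) = i"
    and \<tau>_S [simp]: "\<tau> i \<in> S \<longleftrightarrow> i \<notin> S"
    and A_\<tau> [simp]: "A (\<tau> i) = A i"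
begin

definition J :: "real^'m \<Rightarrow> real^'m^'m" where
  "J p = (\<chi> i l. if l = i then (if i \<in> S then A i p else - A i p)
                 else if l = \<tau> i then (if i \<in> S then - (1 + A i p * A i p) else 1) else 0)"

lemma \<tau>_neq [simp]: "\<tau> i \<noteq> i" "i \<noteq> \<tau> i"
  using \<tau>_S[of i] by metis+

lemma J_nth: "(J p *v v) $ i =
  (if i \<in> S then A i p * v $ i - (1 + A i p * A i p) * v $ \<tau> i else v $ \<tau> i - A i p * v $ i)"
proof -
  have "(J p *v v) $ i = (\<Sum>l\<in>UNIV.
      (if l = i then (if i \<in> S then A i p else - A i p) * v $ i else 0)
      + (if l = \<tau> i then (if i \<in> S then - (1 + A i p * A i p) else 1) * v $ \<tau> i else 0))"
    unfolding matrix_vector_mult_def J_def vec_lambda_beta by (intro sum.cong) auto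
  then show ?thesis by (simp add: sum.distrib algebra_simps)
qed

lemma almost_complex_J: "almost_complex J"
proof -
  have "(J p ** J p) *v v = - v" for p v
    by (simp add: vec_eq_iff J_nth algebra_simps flip: matrix_vector_mul_assoc)
  moreover have "(- mat 1 :: real^'m^'m) *v v = - v" for v
    using matrix_vector_mult_diff_rdistrib[of 0 "mat 1" v] by simp
  ultimately show ?thesis unfolding almost_complex_def by (simp add: matrix_eq)
qed

lemma Ck_structure_J:
  assumes "\<And>i. Ck k (A i) UNIV"
  shows "Ck_structure k J"
  unfolding Ck_structure_def
proof (intro allI)
  fix i l
  have "Ck k (\<lambda>p. 1 + A i p * A i p) UNIV" "Ck k (\<lambda>p. - 1 * A i p) UNIV"
    by (intro Ck_add Ck_mult Ck_const assms)+
  moreover from this(1) have "Ck k (\<lambda>p. - 1 * (1 + A i p * A i p)) UNIV"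
    by (intro Ck_mult Ck_const)
  ultimately show "Ck k (\<lambda>p. J p $ i $ l) UNIV"
    using assms[of i]
    by (cases "l = i"; cases "l = \<tau> i"; cases "i \<in> S") (simp_all add: J_def Ck_const)
qed

lemma integrable_acs_J:
  assumes A': "\<And>i p. (A i has_derivative (\<lambda>h. h $ i * u i p + h $ \<tau> i * v i p)) (at p)"
  shows "integrable_acs J"
  unfolding integrable_acs_def
proof (intro allI impI)
  fix X Y :: "real^'m \<Rightarrow> real^'m" and p
  assume "(\<forall>p. X differentiable at p) \<and> (\<forall>p. Y differentiable at p)"
  then have diff: "X differentiable at p" "Y differentiable at p" by auto
  define D where "D i h = h $ i * u i p + h $ \<tau> i * v i p" for i and h :: "real^'m"
  have D_\<tau>: "D (\<tau> i) h = D i h" for i h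
    using has_derivative_unique[OF A'[of i p] A'[of "\<tau> i" p, simplified]]
    unfolding D_def by (metis \<tau>\<tau>)
  have DJ: "frechet_derivative (applyJ J Z) (at p) =
     (\<lambda>h. \<chi> i. (J p *v frechet_derivative Z (at p) h) $ i
        + (if i \<in> S then D i h * Z p $ i - 2 * A i p * D i h * Z p $ \<tau> i else - D i h * Z p $ i))"
    if "Z differentiable at p" for Z
  proof (rule sym, rule frechet_derivative_at, rule has_derivative_vecI)
    fix i
    have Z: "((\<lambda>x. Z x $ l) has_derivative (\<lambda>h. frechet_derivative Z (at p) h $ l)) (at p)" for l
      using that by (intro bounded_linear.has_derivative[OF bounded_linear_vec_nth])
        (simp add: frechet_derivative_works)
    have A'': "(A i has_derivative D i) (at p)"
      using A' unfolding D_def .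
    show "((\<lambda>x. applyJ J Z x $ i) has_derivative (\<lambda>h. (\<chi> i. (J p *v frechet_derivative Z (at p) h) $ i
        + (if i \<in> S then D i h * Z p $ i - 2 * A i p * D i h * Z p $ \<tau> i else - D i h * Z p $ i)) $ i)) (at p)"
      unfolding applyJ_def J_nth
      by (cases "i \<in> S")
        (auto intro!: derivative_eq_intros Z A'' simp: algebra_simps)
  qed
  show "nijenhuis J X Y p = 0"
  proof (subst vec_eq_iff, intro allI)
    fix i
    show "nijenhuis J X Y p $ i = 0 $ i"
      unfolding nijenhuis_def lie_bracket_def DJ[OF diff(1)] DJ[OF diff(2)]
      by (cases "i \<in> S") (simp_all add: J_nth D_\<tau> applyJ_def, simp_all add: D_def J_nth algebra_simps)
  qed
qed

end

subsection \<open>Holomorphic charts\<close>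

lemma frechet_derivative_J_holomorphic:
  fixes w :: "real^'m \<Rightarrow> complex^'n" and A :: "real^'m^'m"
  assumes diff: "w differentiable (at p)"
    and bij: "bij (frechet_derivative w (at p))"
    and hol: "\<And>j. cx_apply A (coord_dw w p j) = (\<chi> l. \<i> * (coord_dw w p j $ l))"
  shows "frechet_derivative w (at p) (A *v h) $ j = \<i> * frechet_derivative w (at p) h $ j"
proof -
  define D where "D = frechet_derivative w (at p)"
  have lin: "linear D"
    unfolding D_def by (rule linear_frechet_derivative[OF diff])
  interpret D: linear D by (rule lin)
  have inv: "D (inv D v) = v" "inv D (D u) = u" for v u
    using bij by (simp_all add: D_def bij_is_surj surj_f_inv_f bij_is_inj inv_f_f)
  have halves: "a = b \<and> c = - d" if "1 / 2 * a = b / 2 \<and> -1 / 2 * c = d / 2" for a b c d :: real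
    using that by linarith
  have key: "A *v inv D (axis j 1) = inv D (axis j \<i>)" "A *v inv D (axis j \<i>) = - inv D (axis j 1)" for j
  proof -
    define x where "x = inv D (axis j 1)"
    define y where "y = inv D (axis j \<i>)"
    have c: "coord_dw w p j = (\<chi> l. Complex (x $ l / 2) (- y $ l / 2))"
      unfolding coord_dw_def Let_def x_def y_def D_def
      by (simp add: vec_eq_iff complex_eq_iff)
    have half: "(\<chi> l. x $ l / 2) = (1/2) *\<^sub>R x" "(\<chi> l. - y $ l / 2) = (-1/2) *\<^sub>R y"
      by (simp_all add: vec_eq_iff)
    have "(A *v ((1/2) *\<^sub>R x)) $ l = y $ l / 2 \<and> (A *v ((-1/2) *\<^sub>R y)) $ l = x $ l / 2" for l
      using hol[of j, unfolded c cx_apply_def vec_lambda_beta complex.sel half]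
      by (auto simp: vec_eq_iff complex_eq_iff)
    then have "(A *v x) $ l = y $ l \<and> (A *v y) $ l = - x $ l" for l
      unfolding matrix_vector_mult_scaleR vector_scaleR_component real_scaleR_def
      by (metis (no_types, opaque_lifting) halves)
    then show "A *v inv D (axis j 1) = inv D (axis j \<i>)" "A *v inv D (axis j \<i>) = - inv D (axis j 1)"
      unfolding x_def[symmetric] y_def[symmetric]
      by (auto simp: vec_eq_iff)
  qed
  have linInv: "linear (inv D)"
  proof (rule linearI)
    show "inv D (u + v) = inv D u + inv D v" for u v
      using inv(2)[of "inv D u + inv D v"] by (simp add: D.add inv(1))
    show "inv D (c *\<^sub>R u) = c *\<^sub>R inv D u" for c u
      using inv(2)[of "c *\<^sub>R inv D u"] by (simp add: D.scaleR inv(1))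
  qed
  define E where "E u = D (A *v inv D u)" for u
  define I where "I u = (\<chi> l. \<i> * u $ l)" for u :: "complex^'n"
  have linE: "linear E"
    unfolding E_def
    using linear_compose[OF linear_compose[OF linInv matrix_vector_mul_linear[of A]] lin]
    by (simp add: o_def)
  have linI: "linear I"
    unfolding I_def by (intro linearI) (simp_all add: vec_eq_iff algebra_simps)
  have "E = I"
  proof (rule linear_eq_stdbasis[OF linE linI])
    fix b :: "complex^'n" assume "b \<in> Basis"
    then obtain i where "b = axis i 1 \<or> b = axis i \<i>"
      by (auto simp: Basis_vec_def Basis_complex_def)
    then show "E b = I b"
    proof
      assume b: "b = axis i 1"
      show ?thesis unfolding b E_def I_def key inv by (simp add: vec_eq_iff axis_def)
    next
      assume b: "b = axis i \<i>"
      show ?thesis unfolding b E_def I_def key D.neg inv by (simp add: vec_eq_iff axis_def)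
    qed
  qed
  then have "E (D h) = I (D h)" by simp
  then show ?thesis by (simp add: E_def I_def inv vec_eq_iff D_def[symmetric])
qed

lemma CkLip_cong:
  assumes "open U" and "CkLip k f U" and "\<And>x. x \<in> U \<Longrightarrow> f x = g x"
  shows "CkLip k g U"
  using assms(2,3)
proof (induction k arbitrary: f g)
  case 0
  then show ?case by (auto simp: lipschitz_on_def)
next
  case (Suc k)
  have D: "(g has_derivative frechet_derivative f (at x)) (at x)" if "x \<in> U" for x
  proof (rule has_derivative_transform_within_open[OF _ \<open>open U\<close> that])
    show "(f has_derivative frechet_derivative f (at x)) (at x)"
      using Suc.prems(1) that by (simp add: frechet_derivative_works)
  qed (use Suc.prems(2) in simp)
  have "CkLip k (\<lambda>x. frechet_derivative g (at x) i) U" if "i \<in> Basis" for i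
  proof (rule Suc.IH)
    show "CkLip k (\<lambda>x. frechet_derivative f (at x) i) U"
      using Suc.prems(1) that by simp
    show "frechet_derivative f (at x) i = frechet_derivative g (at x) i" if "x \<in> U" for x
      using frechet_derivative_at[OF D[OF that]] by metis
  qed
  then show ?case using D by (auto simp: differentiable_def)
qed

lemma CkLip_vec_nth:
  fixes f :: "'a::euclidean_space \<Rightarrow> complex^'n"
  assumes "open U" and "CkLip k f U"
  shows "CkLip k (\<lambda>x. f x $ j) U"
  using assms(2)
proof (induction k arbitrary: f)
  case 0
  then obtain L where "L-lipschitz_on U f" by auto
  then have "L-lipschitz_on U (\<lambda>x. f x $ j)"
    unfolding lipschitz_on_def using dist_vec_nth_le order_trans by blast
  then show ?case by auto
next
  case (Suc k)
  have D: "((\<lambda>x. f x $ j) has_derivative (\<lambda>h. frechet_derivative f (at x) h $ j)) (at x)" if "x \<in> U" for x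
    using Suc.prems that
    by (intro bounded_linear.has_derivative[OF bounded_linear_vec_nth])
      (simp add: frechet_derivative_works)
  have "CkLip k (\<lambda>x. frechet_derivative (\<lambda>x. f x $ j) (at x) i) U" if "i \<in> Basis" for i
  proof -
    have "CkLip k (\<lambda>x. frechet_derivative f (at x) i $ j) U"
      using Suc that by auto
    moreover have "frechet_derivative f (at x) i $ j = frechet_derivative (\<lambda>x. f x $ j) (at x) i"
      if "x \<in> U" for x using frechet_derivative_at[OF D[OF that]] by metis
    ultimately show ?thesis by (rule CkLip_cong[OF \<open>open U\<close>])
  qed
  then show ?case using D by (auto simp: differentiable_def)
qed

lemma CkLip_imp_continuous_on:
  assumes "CkLip k f U"
  shows "continuous_on U f"
proof (cases k)
  case 0
  then show ?thesis using assms lipschitz_on_continuous_on by auto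
next
  case (Suc k')
  then show ?thesis
    using assms by (auto intro!: continuous_at_imp_continuous_on differentiable_imp_continuous_within)
qed

subsection \<open>Fourier coefficients on small circles\<close>

lemma has_vector_derivative_cis_mult:
  "((\<lambda>t. cis (c * t)) has_vector_derivative (\<i> * of_real c * cis (c * t))) (at t within T)"
  unfolding has_vector_derivative_def
  by (auto intro!: derivative_eq_intros simp: scaleR_conv_of_real)

lemma has_vector_derivative_norm_bound:
  fixes f :: "real \<Rightarrow> 'b::real_normed_vector"
  assumes "a \<le> b"
    and "\<And>x. x \<in> {a..b} \<Longrightarrow> (f has_vector_derivative f' x) (at x within {a..b})"
    and "\<And>x. x \<in> {a..b} \<Longrightarrow> norm (f' x) \<le> B"
  shows "norm (f b - f a) \<le> B * (b - a)"
proof -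
  have "norm (f b - f a) \<le> B * norm (b - a)"
  proof (rule differentiable_bound[of "{a..b}" f "\<lambda>x h. h *\<^sub>R f' x"])
    show "onorm (\<lambda>h. h *\<^sub>R f' x) \<le> B" if "x \<in> {a..b}" for x
      using assms(3)[OF that] by (intro onorm_le) (simp add: mult.commute[of B] mult_left_mono)
  qed (use assms in \<open>auto simp: has_vector_derivative_def\<close>)
  then show ?thesis using assms(1) by simp
qed

lemma integral_cis_eq_0:
  assumes "N \<ge> 1"
  shows "integral {0..2 * pi} (\<lambda>\<theta>. cis (- (real N * \<theta>))) = 0"
proof -
  have "((\<lambda>\<theta>. \<i> * of_real (- real N) * cis (- real N * \<theta>)) has_integral
      cis (- real N * (2 * pi)) - cis (- real N * 0)) {0..2 * pi}"
    by (intro fundamental_theorem_of_calculus has_vector_derivative_cis_mult) simp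
  moreover have "cis (- real N * (2 * pi)) = 1"
    using cis_multiple_2pi[of "- real N"] by (simp add: mult_ac)
  ultimately have "((\<lambda>\<theta>. \<i> * of_real (- real N) * cis (- (real N * \<theta>))) has_integral 0) {0..2 * pi}"
    by simp
  then have "((\<lambda>\<theta>. inverse (\<i> * of_real (- real N)) * (\<i> * of_real (- real N) * cis (- (real N * \<theta>)))) has_integral
      inverse (\<i> * of_real (- real N)) * 0) {0..2 * pi}"
    by (rule has_integral_mult_right)
  then have "((\<lambda>\<theta>. cis (- (real N * \<theta>))) has_integral 0) {0..2 * pi}"
    using assms by (simp add: field_simps)
  then show ?thesis by (rule integral_unique)
qed

locale polar_plane =
  fixes e1 e2 :: "'a::euclidean_space"
  assumes e1: "e1 \<in> Basis" and e2: "e2 \<in> Basis" and e12: "e1 \<noteq> e2"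
begin

definition polar :: "real \<Rightarrow> real \<Rightarrow> 'a" where
  "polar r \<theta> = (r * cos \<theta>) *\<^sub>R e1 + (r * sin \<theta>) *\<^sub>R e2"

definition fourier :: "('a \<Rightarrow> complex) \<Rightarrow> nat \<Rightarrow> real \<Rightarrow> complex" where
  "fourier f N r = integral {0..2 * pi} (\<lambda>\<theta>. f (polar r \<theta>) * cis (- (real N * \<theta>)))"

definition px :: "('a \<Rightarrow> complex) \<Rightarrow> 'a \<Rightarrow> complex" where
  "px f p = frechet_derivative f (at p) e1"

definition py :: "('a \<Rightarrow> complex) \<Rightarrow> 'a \<Rightarrow> complex" where
  "py f p = frechet_derivative f (at p) e2"

lemma norm_polar [simp]: "norm (polar r \<theta>) = \<bar>r\<bar>"
proof -
  have "(norm (polar r \<theta>))\<^sup>2 = (r * cos \<theta>)\<^sup>2 + (r * sin \<theta>)\<^sup>2"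
    unfolding power2_norm_eq_inner polar_def using e1 e2 e12
    by (simp add: inner_left_distrib inner_right_distrib inner_Basis power2_eq_square)
  also have "\<dots> = r\<^sup>2"
    by (simp add: power_mult_distrib flip: distrib_left)
  finally show ?thesis by (simp add: power2_eq_iff_nonneg[of "norm _" "\<bar>r\<bar>", simplified, symmetric])
qed

lemma polar_0 [simp]: "polar 0 \<theta> = 0"
  by (simp add: polar_def)

lemma continuous_on_polar: "continuous_on T (\<lambda>(r, \<theta>). polar r \<theta>)"
  unfolding polar_def case_prod_unfold by (intro continuous_intros)

lemma continuous_on_polar_comp:
  assumes "continuous_on (ball 0 R) f"
  shows "continuous_on ({-R<..<R} \<times> T) (\<lambda>(r, \<theta>). f (polar r \<theta>))"
  using continuous_on_compose2[OF assms continuous_on_polar[of "{-R<..<R} \<times> T"]]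
  by (force simp: case_prod_unfold)

lemma continuous_on_polar_angle:
  assumes "continuous_on (ball 0 R) f" and "\<bar>r\<bar> < R"
  shows "continuous_on T (\<lambda>\<theta>. f (polar r \<theta>))"
proof (rule continuous_on_compose2[OF assms(1)])
  show "continuous_on T (polar r)"
    unfolding polar_def[abs_def] by (intro continuous_intros)
qed (use assms(2) in auto)

lemma norm_fourier_le:
  assumes "continuous_on (ball 0 R) f" and "\<bar>r\<bar> < R"
    and "\<And>\<theta>. norm (f (polar r \<theta>)) \<le> B"
  shows "norm (fourier f N r) \<le> B * (2 * pi)"
proof -
  have "norm (integral {0..2 * pi} (\<lambda>\<theta>. f (polar r \<theta>) * cis (- (real N * \<theta>)))) \<le> B * (2 * pi - 0)"
    by (rule integral_bound)
      (use assms(3) in \<open>auto intro!: continuous_intros continuous_on_polar_angle[OF assms(1,2)] simp: norm_mult\<close>)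
  then show ?thesis by (simp add: fourier_def)
qed

lemma has_vector_derivative_polar_comp:
  assumes "f differentiable (at (polar r \<theta>))"
  shows "((\<lambda>r. f (polar r \<theta>)) has_vector_derivative
      of_real (cos \<theta>) * px f (polar r \<theta>) + of_real (sin \<theta>) * py f (polar r \<theta>)) (at r within T)"
    and "((\<lambda>\<theta>. f (polar r \<theta>)) has_vector_derivative
      of_real r * (of_real (cos \<theta>) * py f (polar r \<theta>) - of_real (sin \<theta>) * px f (polar r \<theta>))) (at \<theta> within T)"
proof -
  define D where "D = frechet_derivative f (at (polar r \<theta>))"
  have f: "(f has_derivative D) (at (polar r \<theta>))"
    using assms by (simp add: D_def frechet_derivative_works)
  interpret D: linear D using f by (rule has_derivative_linear)
  have "((\<lambda>r. polar r \<theta>) has_vector_derivative (cos \<theta> *\<^sub>R e1 + sin \<theta> *\<^sub>R e2)) (at r within T)"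
    unfolding polar_def has_vector_derivative_def
    by (auto intro!: derivative_eq_intros simp: algebra_simps)
  from vector_derivative_diff_chain_within[OF this has_derivative_at_withinI[OF f]]
  show "((\<lambda>r. f (polar r \<theta>)) has_vector_derivative
      of_real (cos \<theta>) * px f (polar r \<theta>) + of_real (sin \<theta>) * py f (polar r \<theta>)) (at r within T)"
    by (simp add: o_def D.add D.scaleR px_def py_def D_def[symmetric] scaleR_conv_of_real)
  have "((\<lambda>\<theta>. polar r \<theta>) has_vector_derivative (r *\<^sub>R (cos \<theta> *\<^sub>R e2 - sin \<theta> *\<^sub>R e1))) (at \<theta> within T)"
    unfolding polar_def has_vector_derivative_def
    by (auto intro!: derivative_eq_intros simp: algebra_simps)
  from vector_derivative_diff_chain_within[OF this has_derivative_at_withinI[OF f]]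
  show "((\<lambda>\<theta>. f (polar r \<theta>)) has_vector_derivative
      of_real r * (of_real (cos \<theta>) * py f (polar r \<theta>) - of_real (sin \<theta>) * px f (polar r \<theta>))) (at \<theta> within T)"
    by (simp add: o_def D.diff D.scaleR px_def py_def D_def[symmetric] scaleR_conv_of_real)
qed

context
  fixes f :: "'a \<Rightarrow> complex" and R :: real
  assumes diff: "\<And>p. p \<in> ball 0 R \<Longrightarrow> f differentiable (at p)"
    and cont: "continuous_on (ball 0 R) (px f)" "continuous_on (ball 0 R) (py f)"
begin

lemma cont_f: "continuous_on (ball 0 R) f"
  using diff by (intro continuous_at_imp_continuous_on ballI differentiable_imp_continuous_within)

lemma fourier_has_vector_derivative:
  assumes r: "\<bar>r\<bar> < R"
  shows "(fourier f N has_vector_derivative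
     integral {0..2 * pi} (\<lambda>\<theta>. (of_real (cos \<theta>) * px f (polar r \<theta>) + of_real (sin \<theta>) * py f (polar r \<theta>))
        * cis (- (real N * \<theta>)))) (at r)"
proof -
  let ?U = "{-R<..<R}"
  have "((\<lambda>r. integral (cbox 0 (2 * pi)) (\<lambda>\<theta>. f (polar r \<theta>) * cis (- (real N * \<theta>)))) has_vector_derivative
     integral (cbox 0 (2 * pi)) (\<lambda>\<theta>. (of_real (cos \<theta>) * px f (polar r \<theta>) + of_real (sin \<theta>) * py f (polar r \<theta>))
        * cis (- (real N * \<theta>)))) (at r within ?U)"
  proof (rule leibniz_rule_vector_derivative)
    show "((\<lambda>r. f (polar r \<theta>) * cis (- (real N * \<theta>))) has_vector_derivative
        (of_real (cos \<theta>) * px f (polar r \<theta>) + of_real (sin \<theta>) * py f (polar r \<theta>))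
        * cis (- (real N * \<theta>))) (at r within ?U)" if "r \<in> ?U" for r \<theta>
      using that by (intro has_vector_derivative_mult_left has_vector_derivative_polar_comp(1) diff) auto
    show "(\<lambda>\<theta>. f (polar r \<theta>) * cis (- (real N * \<theta>))) integrable_on cbox 0 (2 * pi)" if "r \<in> ?U" for r
      using that unfolding cbox_interval
      by (intro integrable_continuous_interval continuous_intros continuous_on_polar_angle[OF cont_f]) auto
    show "continuous_on (?U \<times> cbox 0 (2 * pi)) (\<lambda>(r, \<theta>).
        (of_real (cos \<theta>) * px f (polar r \<theta>) + of_real (sin \<theta>) * py f (polar r \<theta>))
        * cis (- (real N * \<theta>)))"
      unfolding case_prod_unfold
      by (intro continuous_intros cont[THEN continuous_on_polar_comp, unfolded case_prod_unfold])
  qed (use r in auto)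
  moreover have "at r within ?U = at r"
    using r by (intro at_within_open) auto
  ultimately show ?thesis
    unfolding fourier_def[abs_def] by (simp add: cbox_interval)
qed

lemma fourier_derivative_split:
  assumes r: "\<bar>r\<bar> < R"
  shows "(fourier f (Suc N) has_vector_derivative
     (fourier (px f) N r + fourier (px f) (N + 2) r) / 2
     + (fourier (py f) N r - fourier (py f) (N + 2) r) / (2 * \<i>)) (at r)"
proof -
  have *: "(of_real (cos \<theta>) * a + of_real (sin \<theta>) * b) * cis (- (real (Suc N) * \<theta>))
     = (a * cis (- (real N * \<theta>)) + a * cis (- (real (N + 2) * \<theta>))) / 2
      + (b * cis (- (real N * \<theta>)) - b * cis (- (real (N + 2) * \<theta>))) / (2 * \<i>)" for a b \<theta>
  proof -
    define z where "z = cis (- (real (Suc N) * \<theta>))"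
    have 1: "cis (- (real N * \<theta>)) = z * cis \<theta>" "cis (- (real (N + 2) * \<theta>)) = z * cis (- \<theta>)"
      unfolding z_def cis_mult by (rule arg_cong[of _ _ cis], simp add: algebra_simps)+
    have 2: "of_real (cos \<theta>) = (cis \<theta> + cis (- \<theta>)) / 2" "of_real (sin \<theta>) = (cis \<theta> - cis (- \<theta>)) / (2 * \<i>)"
      by (simp_all add: complex_eq_iff)
    show ?thesis unfolding 1 2 z_def[symmetric] by (simp add: field_simps)
  qed
  have int: "(\<lambda>\<theta>. h (polar r \<theta>) * cis (- (real M * \<theta>))) integrable_on {0..2 * pi}"
    if "continuous_on (ball 0 R) h" for h M
    by (intro integrable_continuous_interval continuous_intros continuous_on_polar_angle[OF that r])
  have "((\<lambda>\<theta>. (of_real (cos \<theta>) * px f (polar r \<theta>) + of_real (sin \<theta>) * py f (polar r \<theta>)) * cis (- (real (Suc N) * \<theta>)))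
     has_integral (fourier (px f) N r + fourier (px f) (N + 2) r) / 2
     + (fourier (py f) N r - fourier (py f) (N + 2) r) / (2 * \<i>)) {0..2 * pi}"
    unfolding * fourier_def
    by (intro has_integral_add has_integral_diff has_integral_divide integrable_integral int cont)
  from integral_unique[OF this] show ?thesis
    using fourier_has_vector_derivative[OF r, of "Suc N"] by simp
qed

lemma fourier_by_parts:
  assumes r: "\<bar>r\<bar> < R"
  shows "\<i> * of_nat N * fourier f N r = of_real r *
     integral {0..2 * pi} (\<lambda>\<theta>. (of_real (cos \<theta>) * py f (polar r \<theta>) - of_real (sin \<theta>) * px f (polar r \<theta>))
        * cis (- (real N * \<theta>)))"
proof -
  let ?g = "\<lambda>\<theta>. of_real (cos \<theta>) * py f (polar r \<theta>) - of_real (sin \<theta>) * px f (polar r \<theta>)"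
  let ?c = "\<lambda>\<theta>. cis (- (real N * \<theta>))"
  have c: "(?c has_vector_derivative (- (\<i> * of_nat N * ?c \<theta>))) (at \<theta> within T)" for \<theta> T
    using has_vector_derivative_cis_mult[of "- real N" \<theta> T] by simp
  have "((\<lambda>\<theta>. f (polar r \<theta>) * (- (\<i> * of_nat N * ?c \<theta>)) + (of_real r * ?g \<theta>) * ?c \<theta>) has_integral
      f (polar r (2 * pi)) * ?c (2 * pi) - f (polar r 0) * ?c 0) {0..2 * pi}"
    using r by (intro fundamental_theorem_of_calculus has_vector_derivative_mult
        has_vector_derivative_polar_comp(2) diff c) auto
  moreover have "?c (2 * pi) = 1"
    using cis_multiple_2pi[of "- real N"] by (simp add: mult_ac)
  ultimately have "((\<lambda>\<theta>. of_real r * (?g \<theta> * ?c \<theta>) - \<i> * of_nat N * (f (polar r \<theta>) * ?c \<theta>)) has_integral 0) {0..2 * pi}"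
    by (simp add: polar_def algebra_simps)
  moreover have "((\<lambda>\<theta>. of_real r * (?g \<theta> * ?c \<theta>) - \<i> * of_nat N * (f (polar r \<theta>) * ?c \<theta>)) has_integral
     of_real r * integral {0..2 * pi} (\<lambda>\<theta>. ?g \<theta> * ?c \<theta>) - \<i> * of_nat N * fourier f N r) {0..2 * pi}"
    unfolding fourier_def
    by (intro has_integral_diff has_integral_mult_right integrable_integral integrable_continuous_interval
        continuous_intros continuous_on_polar_angle[OF _ r] cont cont_f)
  ultimately have "of_real r * integral {0..2 * pi} (\<lambda>\<theta>. ?g \<theta> * ?c \<theta>) - \<i> * of_nat N * fourier f N r = 0"
    by (rule has_integral_unique[rotated])
  then show ?thesis by simp
qed

text \<open>In polar coordinates \<open>f_x + \<i> f_y = e^{\<i>\<theta>} (f_r + (\<i> / r) f_\<theta>)\<close>.\<close>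
lemma fourier_dbar:
  assumes r: "\<bar>r\<bar> < R"
  shows "\<exists>D. (fourier f N has_vector_derivative D) (at r) \<and>
     of_real r * D - of_nat N * fourier f N r =
     of_real r * integral {0..2 * pi} (\<lambda>\<theta>. (px f (polar r \<theta>) + \<i> * py f (polar r \<theta>))
        * cis (- (real (Suc N) * \<theta>)))"
proof (intro exI conjI)
  let ?c = "\<lambda>\<theta>. cis (- (real N * \<theta>))"
  let ?P = "\<lambda>\<theta>. of_real (cos \<theta>) * px f (polar r \<theta>) + of_real (sin \<theta>) * py f (polar r \<theta>)"
  let ?Q = "\<lambda>\<theta>. of_real (cos \<theta>) * py f (polar r \<theta>) - of_real (sin \<theta>) * px f (polar r \<theta>)"
  show "(fourier f N has_vector_derivative integral {0..2 * pi} (\<lambda>\<theta>. ?P \<theta> * ?c \<theta>)) (at r)"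
    by (rule fourier_has_vector_derivative[OF r])
  have parts: "of_nat N * fourier f N r = - \<i> * (of_real r * integral {0..2 * pi} (\<lambda>\<theta>. ?Q \<theta> * ?c \<theta>))"
    unfolding fourier_by_parts[OF r, symmetric] by (simp flip: mult.assoc)
  have "(px f (polar r \<theta>) + \<i> * py f (polar r \<theta>)) * cis (- (real (Suc N) * \<theta>)) = ?P \<theta> * ?c \<theta> + \<i> * (?Q \<theta> * ?c \<theta>)" for \<theta>
  proof -
    have "cis (- (real (Suc N) * \<theta>)) = cis (- \<theta>) * ?c \<theta>"
      by (simp add: cis_mult algebra_simps)
    moreover have "cis (- \<theta>) = of_real (cos \<theta>) - \<i> * of_real (sin \<theta>)"
      by (simp add: complex_eq_iff)
    moreover have "(a + \<i> * b) * ((c - \<i> * s) * z) = (c * a + s * b) * z + \<i> * ((c * b - s * a) * z)"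
      for a b c s z :: complex by (simp add: algebra_simps)
    ultimately show ?thesis by simp
  qed
  moreover have "((\<lambda>\<theta>. ?P \<theta> * ?c \<theta> + \<i> * (?Q \<theta> * ?c \<theta>)) has_integral
      integral {0..2 * pi} (\<lambda>\<theta>. ?P \<theta> * ?c \<theta>) + \<i> * integral {0..2 * pi} (\<lambda>\<theta>. ?Q \<theta> * ?c \<theta>)) {0..2 * pi}"
    by (intro has_integral_add has_integral_mult_right integrable_integral integrable_continuous_interval
        continuous_intros continuous_on_polar_angle[OF _ r] cont cont_f)
  ultimately have "integral {0..2 * pi} (\<lambda>\<theta>. (px f (polar r \<theta>) + \<i> * py f (polar r \<theta>)) * cis (- (real (Suc N) * \<theta>)))
      = integral {0..2 * pi} (\<lambda>\<theta>. ?P \<theta> * ?c \<theta>) + \<i> * integral {0..2 * pi} (\<lambda>\<theta>. ?Q \<theta> * ?c \<theta>)"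
    by (simp add: integral_unique)
  then show "of_real r * integral {0..2 * pi} (\<lambda>\<theta>. ?P \<theta> * ?c \<theta>) - of_nat N * fourier f N r =
     of_real r * integral {0..2 * pi} (\<lambda>\<theta>. (px f (polar r \<theta>) + \<i> * py f (polar r \<theta>))
        * cis (- (real (Suc N) * \<theta>)))"
    unfolding parts by (simp add: algebra_simps)
qed

end

text \<open>Differentiating in \<open>r\<close> shifts the frequency by one and lowers \<open>k\<close> by one, so frequencies above \<open>k\<close> stay above \<open>k\<close>.\<close>
lemma fourier_bound:
  assumes "CkLip k f U" and "ball 0 R \<subseteq> U" and "R > 0" and "N > k"
  shows "\<exists>C\<ge>0. \<forall>r. 0 \<le> r \<longrightarrow> r < R \<longrightarrow> norm (fourier f N r) \<le> C * r ^ Suc k"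
  using assms(1,4)
proof (induction k arbitrary: f N)
  case 0
  then obtain L where L: "L-lipschitz_on U f" by auto
  have cont: "continuous_on (ball 0 R) f"
    using CkLip_imp_continuous_on[OF 0(1)] assms(2) continuous_on_subset by blast
  have "norm (fourier f N r) \<le> (2 * pi * L) * r ^ Suc 0" if r: "0 \<le> r" "r < R" for r
  proof -
    have "((\<lambda>\<theta>. f (polar r \<theta>) * cis (- (real N * \<theta>)) - f 0 * cis (- (real N * \<theta>))) has_integral
        fourier f N r - f 0 * integral {0..2 * pi} (\<lambda>\<theta>. cis (- (real N * \<theta>)))) {0..2 * pi}"
      unfolding fourier_def using r
      by (intro has_integral_diff has_integral_mult_right integrable_integral integrable_continuous_interval
        continuous_intros continuous_on_polar_angle[OF cont]) auto
    then have "fourier f N r = fourier (\<lambda>p. f p - f 0) N r"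
      using integral_cis_eq_0[of N] 0(2) unfolding fourier_def
      by (simp add: integral_unique left_diff_distrib)
    also have "norm \<dots> \<le> (L * r) * (2 * pi)"
    proof (rule norm_fourier_le)
      show "continuous_on (ball 0 R) (\<lambda>p. f p - f 0)" by (intro continuous_intros cont)
      show "norm (f (polar r \<theta>) - f 0) \<le> L * r" for \<theta>
        using lipschitz_onD[OF L, of "polar r \<theta>" 0] r assms(2)
        by (auto simp: dist_norm subset_iff)
    qed (use r in auto)
    finally show ?thesis by (simp add: mult_ac)
  qed
  moreover have "L \<ge> 0" using L lipschitz_on_nonneg by blast
  ultimately show ?case by (intro exI[of _ "2 * pi * L"]) auto
next
  case (Suc k)
  obtain N' where N: "N = Suc N'" "N' > k" using Suc.prems(2) by (cases N) auto
  have lip: "CkLip k (px f) U" "CkLip k (py f) U"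
    using Suc.prems(1) e1 e2 by (auto simp: px_def[abs_def] py_def[abs_def])
  have cont: "continuous_on (ball 0 R) (px f)" "continuous_on (ball 0 R) (py f)"
    using lip[THEN CkLip_imp_continuous_on] assms(2) continuous_on_subset by blast+
  have diff: "f differentiable (at p)" if "p \<in> ball 0 R" for p
    using that Suc.prems(1) assms(2) by auto
  obtain C1 C2 C3 C4 where C: "C1 \<ge> 0" "C2 \<ge> 0" "C3 \<ge> 0" "C4 \<ge> 0"
    and C': "\<And>r. 0 \<le> r \<Longrightarrow> r < R \<Longrightarrow> norm (fourier (px f) N' r) \<le> C1 * r ^ Suc k"
      "\<And>r. 0 \<le> r \<Longrightarrow> r < R \<Longrightarrow> norm (fourier (px f) (N' + 2) r) \<le> C2 * r ^ Suc k"
      "\<And>r. 0 \<le> r \<Longrightarrow> r < R \<Longrightarrow> norm (fourier (py f) N' r) \<le> C3 * r ^ Suc k"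
      "\<And>r. 0 \<le> r \<Longrightarrow> r < R \<Longrightarrow> norm (fourier (py f) (N' + 2) r) \<le> C4 * r ^ Suc k"
  proof -
    have "N' + 2 > k" using N(2) by simp
    note IH = Suc.IH[OF lip(1) N(2)] Suc.IH[OF lip(1) this] Suc.IH[OF lip(2) N(2)] Suc.IH[OF lip(2) this]
    from IH obtain C1 C2 C3 C4 where "C1 \<ge> 0" "C2 \<ge> 0" "C3 \<ge> 0" "C4 \<ge> 0"
      "\<forall>r. 0 \<le> r \<longrightarrow> r < R \<longrightarrow> norm (fourier (px f) N' r) \<le> C1 * r ^ Suc k"
      "\<forall>r. 0 \<le> r \<longrightarrow> r < R \<longrightarrow> norm (fourier (px f) (N' + 2) r) \<le> C2 * r ^ Suc k"
      "\<forall>r. 0 \<le> r \<longrightarrow> r < R \<longrightarrow> norm (fourier (py f) N' r) \<le> C3 * r ^ Suc k"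
      "\<forall>r. 0 \<le> r \<longrightarrow> r < R \<longrightarrow> norm (fourier (py f) (N' + 2) r) \<le> C4 * r ^ Suc k"
      by (elim exE conjE)
    then show thesis by (intro that[of C1 C2 C3 C4]) auto
  qed
  define C where "C = C1 + C2 + C3 + C4"
  let ?D = "\<lambda>r. (fourier (px f) N' r + fourier (px f) (N' + 2) r) / 2
     + (fourier (py f) N' r - fourier (py f) (N' + 2) r) / (2 * \<i>)"
  have D: "norm (?D r) \<le> C * r ^ Suc k" if "0 \<le> r" "r < R" for r
  proof -
    have "norm (?D r) \<le> (norm (fourier (px f) N' r) + norm (fourier (px f) (N' + 2) r)) / 2
       + (norm (fourier (py f) N' r) + norm (fourier (py f) (N' + 2) r)) / 2"
      by (rule order_trans[OF norm_triangle_ineq])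
         (auto simp: norm_divide norm_mult intro!: add_mono divide_right_mono norm_triangle_ineq norm_triangle_ineq4)
    also have "\<dots> \<le> (C1 * r ^ Suc k + C2 * r ^ Suc k) / 2 + (C3 * r ^ Suc k + C4 * r ^ Suc k) / 2"
      using C'[OF that] by (intro add_mono divide_right_mono) auto
    also have "\<dots> \<le> C * r ^ Suc k"
    proof -
      have nonneg: "0 \<le> c * r ^ Suc k" if "c \<ge> 0" for c using that \<open>0 \<le> r\<close> by simp
      have half_sum_le: "(a + b) / 2 + (c + d) / 2 \<le> a + b + c + d"
        if "0 \<le> a" "0 \<le> b" "0 \<le> c" "0 \<le> d" for a b c d :: real
        using that by (simp add: field_simps)
      from nonneg[OF C(1)] nonneg[OF C(2)] nonneg[OF C(3)] nonneg[OF C(4)] show ?thesis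
        unfolding C_def distrib_right by (rule half_sum_le)
    qed
    finally show ?thesis .
  qed
  have D': "(fourier f (Suc N') has_vector_derivative ?D x) (at x)" if "\<bar>x\<bar> < R" for x
    by (rule fourier_derivative_split[where R = R]) (fact diff cont that)+
  have "norm (fourier f N r) \<le> C * r ^ Suc (Suc k)" if r: "0 \<le> r" "r < R" for r
  proof -
    have "norm (fourier f N r - fourier f N 0) \<le> (C * r ^ Suc k) * (r - 0)"
    proof (rule has_vector_derivative_norm_bound)
      show "(fourier f N has_vector_derivative ?D x) (at x within {0..r})" if "x \<in> {0..r}" for x
        unfolding N(1) by (rule has_vector_derivative_at_within, rule D') (use that r in auto)
      show "norm (?D x) \<le> C * r ^ Suc k" if "x \<in> {0..r}" for x
      proof -
        have "norm (?D x) \<le> C * x ^ Suc k" using that r by (intro D) auto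
        also have "\<dots> \<le> C * r ^ Suc k"
          using that C unfolding C_def by (intro mult_left_mono power_mono) auto
        finally show ?thesis .
      qed
    qed (use r in auto)
    moreover have "fourier f N 0 = 0"
      using integral_cis_eq_0[of N] Suc.prems(2) by (simp add: fourier_def)
    ultimately show ?thesis using r by (simp add: mult_ac)
  qed
  moreover have "C \<ge> 0" using C by (simp add: C_def)
  ultimately show ?case by blast
qed

end

lemma has_integral_cos_power_cis:
  "((\<lambda>\<theta>. of_real (cos \<theta> ^ n) * cis (- (real n * \<theta>))) has_integral of_real (2 * pi / 2 ^ n)) {0..2 * pi}"
proof -
  have "((\<lambda>\<theta>. (1 + cis (- (2 * \<theta>))) ^ n * cis (- (real (2 * j) * \<theta>))) has_integral
      (if j = 0 then of_real (2 * pi) else 0)) {0..2 * pi}" for j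
  proof (induction n arbitrary: j)
    case 0
    show ?case
    proof (cases "j = 0")
      case True
      then show ?thesis using has_integral_const_real[of "1::complex" 0 "2 * pi"]
        by (simp add: scaleR_conv_of_real)
    next
      case False
      have "(\<lambda>\<theta>. cis (- (real (2 * j) * \<theta>))) integrable_on {0..2 * pi}"
        by (intro integrable_continuous_interval continuous_intros)
      from integrable_integral[OF this] show ?thesis
        unfolding power_0 mult_1_left using integral_cis_eq_0[of "2 * j"] False by (simp only: if_False)
    qed
  next
    case (Suc n)
    have "cis (- (2 * \<theta>)) * cis (- (real (2 * j) * \<theta>)) = cis (- (real (2 * Suc j) * \<theta>))" for \<theta>
      unfolding cis_mult by (rule arg_cong[of _ _ cis]) (simp add: algebra_simps)
    then have "(1 + cis (- (2 * \<theta>))) ^ Suc n * cis (- (real (2 * j) * \<theta>))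
      = (1 + cis (- (2 * \<theta>))) ^ n * cis (- (real (2 * j) * \<theta>))
        + (1 + cis (- (2 * \<theta>))) ^ n * cis (- (real (2 * Suc j) * \<theta>))" for \<theta>
      by (simp add: ring_distribs mult_ac)
    then show ?case
      using has_integral_add[OF Suc.IH[of j] Suc.IH[of "Suc j"]] by (simp only: if_False add_0_right nat.distinct)
  qed
  from has_integral_divide[OF this[of 0], of "2 ^ n"]
  have "((\<lambda>\<theta>. (1 + cis (- (2 * \<theta>))) ^ n / 2 ^ n) has_integral of_real (2 * pi / 2 ^ n)) {0..2 * pi}"
    by simp
  moreover have "of_real (cos \<theta> ^ n) * cis (- (real n * \<theta>)) = (1 + cis (- (2 * \<theta>))) ^ n / 2 ^ n" for \<theta>
  proof -
    have "of_real (cos \<theta>) * cis (- \<theta>) = (1 + cis (- (2 * \<theta>))) / 2"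
    proof -
      have c: "of_real (cos \<theta>) = (cis \<theta> + cis (- \<theta>)) / 2"
        by (simp add: complex_eq_iff)
      show ?thesis unfolding c by (simp add: cis_mult distrib_right)
    qed
    then have "(of_real (cos \<theta>) * cis (- \<theta>)) ^ n = ((1 + cis (- (2 * \<theta>))) / 2) ^ n"
      by (rule arg_cong)
    then show ?thesis
      unfolding power_mult_distrib Complex.DeMoivre power_divide by simp
  qed
  ultimately show ?thesis by simp
qed

subsection \<open>The counterexample\<close>

text \<open>The \<open>j\<close>-th derivative of \<open>-t / (1 + t^2)\<close>, which is the negative real part of \<open>1 / (t - \<i>)\<close>.\<close>
definition slow :: "nat \<Rightarrow> real \<Rightarrow> real" where
  "slow j t = - Re ((-1) ^ j * fact j / (of_real t - \<i>) ^ Suc j)"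

lemma slow_0: "slow 0 t = - t / (1 + t\<^sup>2)"
  by (simp add: slow_def Re_divide power2_eq_square)

lemma slow_deriv: "(slow j has_real_derivative slow (Suc j) t) (at t)"
proof -
  have nz: "of_real t - \<i> \<noteq> 0" for t by (simp add: complex_eq_iff)
  have power: "of_nat j * (of_real t - \<i>) ^ (j - Suc 0) * (of_real t - \<i>) = of_nat j * (of_real t - \<i>) ^ j"
    by (cases j) auto
  have "((\<lambda>z. (-1) ^ j * fact j / (z - \<i>) ^ Suc j) has_field_derivative
      (-1) ^ Suc j * fact (Suc j) / (of_real t - \<i>) ^ Suc (Suc j)) (at (of_real t))"
    using nz[of t] by (auto intro!: derivative_eq_intros simp: divide_simps power distrib_right)
      (simp add: algebra_simps)
  from bounded_linear.has_vector_derivative[OF bounded_linear_Re has_vector_derivative_real_field[OF this]]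
  have "((\<lambda>t. Re ((-1) ^ j * fact j / (of_real t - \<i>) ^ Suc j)) has_real_derivative
      Re ((-1) ^ Suc j * fact (Suc j) / (of_real t - \<i>) ^ Suc (Suc j))) (at t)"
    by (simp only: has_real_derivative_iff_has_vector_derivative)
  from DERIV_minus[OF this] show ?thesis unfolding slow_def[abs_def] .
qed

lemma slow_lim: "(slow j \<longlongrightarrow> 0) at_bot"
proof (rule Lim_null_comparison)
  have "((\<lambda>t::real. fact j * (1 / \<bar>t\<bar>)) \<longlongrightarrow> fact j * 0) at_bot"
    by (intro tendsto_mult tendsto_const) real_asymp
  then show "((\<lambda>t::real. fact j / \<bar>t\<bar>) \<longlongrightarrow> 0) at_bot" by simp
  show "eventually (\<lambda>t. norm (slow j t) \<le> fact j / \<bar>t\<bar>) at_bot"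
    using eventually_le_at_bot[of "-1"]
  proof (rule eventually_mono)
    fix t :: real assume t: "t \<le> -1"
    have 1: "\<bar>t\<bar> \<le> norm (of_real t - \<i>)"
      using abs_Re_le_cmod[of "of_real t - \<i>"] by simp
    have "\<bar>t\<bar> ^ 1 \<le> \<bar>t\<bar> ^ Suc j" using t by (intro power_increasing) auto
    also have "\<dots> \<le> norm (of_real t - \<i>) ^ Suc j" using 1 by (intro power_mono) auto
    finally have 2: "\<bar>t\<bar> \<le> norm (of_real t - \<i>) ^ Suc j" by simp
    have "norm (slow j t) \<le> norm ((-1) ^ j * fact j / (of_real t - \<i>) ^ Suc j)"
      unfolding slow_def by (simp only: real_norm_def abs_minus_cancel abs_Re_le_cmod)
    also have "\<dots> = fact j / norm (of_real t - \<i>) ^ Suc j"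
      by (simp add: norm_divide norm_mult norm_power)
    also have "\<dots> \<le> fact j / \<bar>t\<bar>"
    proof (rule divide_left_mono)
      have "\<bar>t\<bar> > 0" using t by simp
      with 2 show "norm (of_real t - \<i>) ^ Suc j * \<bar>t\<bar> > 0" by (intro mult_pos_pos) linarith+
    qed (use 2 in auto)
    finally show "norm (slow j t) \<le> fact j / \<bar>t\<bar>" .
  qed
qed

lemma slow_antiderivative:
  assumes "r > 0"
  shows "((\<lambda>r. - ln (1 + (ln (r\<^sup>2))\<^sup>2) / 4) has_real_derivative slow 0 (ln (r\<^sup>2)) / r) (at r)"
proof -
  have "1 + (ln (r\<^sup>2))\<^sup>2 > 0" by (simp add: add_pos_nonneg)
  then show ?thesis
    using assms unfolding slow_0
    by (auto intro!: derivative_eq_intros simp: divide_simps power2_eq_square)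
qed

context polar_plane
begin

lemma no_CkLip_solution:
  assumes lip: "CkLip k f U" and U: "open U" "0 \<in> U" and k: "k \<ge> 1"
    and A: "\<And>r \<theta>. A (polar r \<theta>) = (r * cos \<theta>) ^ (k + 2) * slow 0 (ln (r\<^sup>2)) / r\<^sup>2"
    and eq: "\<And>p. p \<in> U \<Longrightarrow> py f p = (\<i> - of_real (A p)) * px f p"
  shows "px f 0 = 0"
proof (rule ccontr)
  assume nz: "px f 0 \<noteq> 0"
  obtain R where R: "R > 0" "ball 0 R \<subseteq> U" using U openE by blast
  obtain k' where k': "k = Suc k'" using k by (cases k) auto
  have diff: "f differentiable (at p)" if "p \<in> ball 0 R" for p
    using lip R that k' by auto
  have cont: "continuous_on (ball 0 R) (px f)" "continuous_on (ball 0 R) (py f)"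
  proof -
    have "CkLip k' (px f) U" "CkLip k' (py f) U"
      using lip k' e1 e2 by (auto simp: px_def[abs_def] py_def[abs_def])
    from this[THEN CkLip_imp_continuous_on]
    show "continuous_on (ball 0 R) (px f)" "continuous_on (ball 0 R) (py f)"
      using R(2) continuous_on_subset by blast+
  qed
  define c where "c = px f 0 * of_real (2 * pi / 2 ^ (k + 2))"
  have c: "c \<noteq> 0" using nz by (simp add: c_def)
  let ?w = "\<lambda>\<theta>. of_real (cos \<theta> ^ (k + 2)) * cis (- (real (k + 2) * \<theta>))"
  define I where "I r = integral {0..2 * pi} (\<lambda>\<theta>. px f (polar r \<theta>) * ?w \<theta>)" for r
  have int: "(\<lambda>\<theta>. px f (polar r \<theta>) * ?w \<theta>) integrable_on {0..2 * pi}" if "\<bar>r\<bar> < R" for r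
    by (intro integrable_continuous_interval continuous_intros continuous_on_polar_angle[OF cont(1) that])
  obtain \<delta> where \<delta>: "0 < \<delta>" "\<delta> < R" "\<delta> < 1" "\<And>r. 0 \<le> r \<Longrightarrow> r \<le> \<delta> \<Longrightarrow> norm (I r - c) \<le> norm c / 2"
  proof -
    define \<epsilon> where "\<epsilon> = norm c / (4 * pi)"
    have "\<epsilon> > 0" using c by (simp add: \<epsilon>_def)
    have "isCont (px f) 0" using cont(1) R(1) by (simp add: continuous_on_eq_continuous_at)
    then obtain d where d: "d > 0" "\<And>p. dist p 0 < d \<Longrightarrow> dist (px f p) (px f 0) < \<epsilon>"
      using \<open>\<epsilon> > 0\<close> unfolding continuous_at_eps_delta by blast
    define \<delta> where "\<delta> = min (min d R) 1 / 2"
    have "norm (I r - c) \<le> norm c / 2" if r: "0 \<le> r" "r \<le> \<delta>" for r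
    proof -
      have r': "\<bar>r\<bar> < R" "\<bar>r\<bar> < d" using r R(1) d(1) by (auto simp: \<delta>_def min_def split: if_splits)
      have "((\<lambda>\<theta>. px f (polar r \<theta>) * ?w \<theta> - px f 0 * ?w \<theta>) has_integral (I r - c)) {0..2 * pi}"
        unfolding I_def c_def using int[OF r'(1)]
        by (intro has_integral_diff integrable_integral has_integral_mult_right has_integral_cos_power_cis) auto
      then have "I r - c = integral {0..2 * pi} (\<lambda>\<theta>. px f (polar r \<theta>) * ?w \<theta> - px f 0 * ?w \<theta>)"
        by (rule integral_unique[symmetric])
      also have "norm \<dots> \<le> \<epsilon> * (2 * pi - 0)"
      proof (rule integral_bound)
        show "continuous_on {0..2 * pi} (\<lambda>\<theta>. px f (polar r \<theta>) * ?w \<theta> - px f 0 * ?w \<theta>)"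
          by (intro continuous_intros continuous_on_polar_angle[OF cont(1) r'(1)])
        fix \<theta>
        have "norm (px f (polar r \<theta>) - px f 0) * \<bar>cos \<theta>\<bar> ^ (k + 2) \<le> \<epsilon> * 1"
          using d(2)[of "polar r \<theta>"] r' \<open>\<epsilon> > 0\<close>
          by (intro mult_mono power_le_one) (auto simp: dist_norm)
        moreover have "norm (px f (polar r \<theta>) * ?w \<theta> - px f 0 * ?w \<theta>)
            = norm (px f (polar r \<theta>) - px f 0) * \<bar>cos \<theta>\<bar> ^ (k + 2)"
          unfolding left_diff_distrib[symmetric] norm_mult norm_cis norm_of_real power_abs by simp
        ultimately show "norm (px f (polar r \<theta>) * ?w \<theta> - px f 0 * ?w \<theta>) \<le> \<epsilon>"
          by simp
      qed simp
      finally show ?thesis by (simp add: \<epsilon>_def)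
    qed
    moreover have "0 < \<delta>" "\<delta> < R" "\<delta> < 1" using R(1) d(1) by (auto simp: \<delta>_def min_def)
    ultimately show thesis by (intro that)
  qed
  define F where "F r = fourier f (Suc k) r / of_real r ^ Suc k" for r
  have F': "(F has_vector_derivative (- \<i> * of_real (slow 0 (ln (r\<^sup>2)) / r) * I r)) (at r)"
    if r: "0 < r" "r < R" for r
  proof -
    have "\<bar>r\<bar> < R" using r by simp
    obtain D where D: "(fourier f (Suc k) has_vector_derivative D) (at r)"
      and D_eq: "of_real r * D - of_nat (Suc k) * fourier f (Suc k) r = of_real r *
        integral {0..2 * pi} (\<lambda>\<theta>. (px f (polar r \<theta>) + \<i> * py f (polar r \<theta>)) * cis (- (real (Suc (Suc k)) * \<theta>)))"
      using fourier_dbar[of R f, OF diff cont \<open>\<bar>r\<bar> < R\<close>, of "Suc k"] by blast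
    define q where "q = - \<i> * of_real (r ^ k * slow 0 (ln (r\<^sup>2)))"
    have "(px f (polar r \<theta>) + \<i> * py f (polar r \<theta>)) * cis (- (real (Suc (Suc k)) * \<theta>))
        = q * (px f (polar r \<theta>) * ?w \<theta>)" for \<theta>
    proof -
      have "polar r \<theta> \<in> U" using \<open>\<bar>r\<bar> < R\<close> R(2) by (auto simp: subset_iff)
      then have "px f (polar r \<theta>) + \<i> * py f (polar r \<theta>) = - \<i> * of_real (A (polar r \<theta>)) * px f (polar r \<theta>)"
        by (simp add: eq algebra_simps)
      also have "A (polar r \<theta>) = r ^ k * slow 0 (ln (r\<^sup>2)) * cos \<theta> ^ (k + 2)"
        using r by (simp add: A power_mult_distrib power2_eq_square)
      finally show ?thesis by (simp add: q_def mult_ac)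
    qed
    then have "integral {0..2 * pi} (\<lambda>\<theta>. (px f (polar r \<theta>) + \<i> * py f (polar r \<theta>)) * cis (- (real (Suc (Suc k)) * \<theta>)))
        = q * I r"
      unfolding I_def by (simp only: integral_mult_right)
    with D_eq have D_eq': "of_real r * D - of_nat (Suc k) * fourier f (Suc k) r = of_real r * (q * I r)"
      by simp
    have p: "((\<lambda>r. inverse (complex_of_real r ^ Suc k)) has_vector_derivative
        - (of_nat (Suc k) * inverse (of_real r ^ Suc (Suc k)))) (at r)"
    proof -
      have "((\<lambda>z::complex. inverse (z ^ Suc k)) has_field_derivative
        - (of_nat (Suc k) * inverse (of_real r ^ Suc (Suc k)))) (at (of_real r))"
        using r by (auto intro!: derivative_eq_intros simp: field_simps) (simp add: k')
      then show ?thesis by (rule has_vector_derivative_real_field)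
    qed
    have "(F has_vector_derivative (fourier f (Suc k) r * - (of_nat (Suc k) * inverse (of_real r ^ Suc (Suc k)))
        + D * inverse (of_real r ^ Suc k))) (at r)"
      unfolding F_def[abs_def] divide_inverse by (rule has_vector_derivative_mult[OF D p])
    also have "fourier f (Suc k) r * - (of_nat (Suc k) * inverse (of_real r ^ Suc (Suc k)))
        + D * inverse (of_real r ^ Suc k) =
        (of_real r * D - of_nat (Suc k) * fourier f (Suc k) r) * inverse (of_real r ^ Suc (Suc k))"
      using r by (simp add: field_simps)
    also have "\<dots> = - \<i> * of_real (slow 0 (ln (r\<^sup>2)) / r) * I r"
      unfolding D_eq' q_def using r by (simp add: field_simps)
    finally show ?thesis .
  qed
  obtain C where C: "C \<ge> 0" "\<And>r. 0 \<le> r \<Longrightarrow> r < R \<Longrightarrow> norm (fourier f (Suc k) r) \<le> C * r ^ Suc k"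
    using fourier_bound[OF lip R(2,1), of "Suc k"] by auto
  have F_bound: "norm (F r) \<le> C" if "0 < r" "r < R" for r
    using C(2)[of r] that by (simp add: F_def norm_divide norm_mult norm_power field_simps)
  define H where "H r = - ln (1 + (ln (r\<^sup>2))\<^sup>2) / 4" for r :: real
  define u where "u r = Re (\<i> * F r / c)" for r
  have u': "(u has_real_derivative slow 0 (ln (r\<^sup>2)) / r * Re (I r / c)) (at r)" if r: "0 < r" "r < R" for r
  proof -
    have "((\<lambda>r. Re (F r * (\<i> / c))) has_vector_derivative
        Re ((- \<i> * of_real (slow 0 (ln (r\<^sup>2)) / r) * I r) * (\<i> / c))) (at r)"
      by (intro bounded_linear.has_vector_derivative[OF bounded_linear_Re]
          has_vector_derivative_mult_left F' r)
    moreover have "(- \<i> * of_real (slow 0 (ln (r\<^sup>2)) / r) * I r) * (\<i> / c)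
        = of_real (slow 0 (ln (r\<^sup>2)) / r) * (I r / c)"
      by (simp add: field_simps)
    moreover have "(\<lambda>r. Re (F r * (\<i> / c))) = u"
      by (simp add: u_def fun_eq_iff mult.commute)
    ultimately have "(u has_vector_derivative Re (of_real (slow 0 (ln (r\<^sup>2)) / r) * (I r / c))) (at r)"
      by metis
    then show ?thesis
      unfolding has_real_derivative_iff_has_vector_derivative by (metis Re_complex_of_real Im_complex_of_real complex.sel(1) mult_zero_left diff_zero times_complex.sel(1))
  qed
  have mono: "u r - H r / 2 \<le> u \<delta> - H \<delta> / 2" if r: "0 < r" "r \<le> \<delta>" for r
  proof (rule DERIV_nonneg_imp_nondecreasing[OF r(2)])
    fix x assume x: "r \<le> x" "x \<le> \<delta>"
    then have x': "0 < x" "x < R" "x < 1" using r \<delta> by auto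
    have "((\<lambda>r. u r - H r / 2) has_real_derivative
        slow 0 (ln (x\<^sup>2)) / x * Re (I x / c) - slow 0 (ln (x\<^sup>2)) / x / 2) (at x)"
      unfolding H_def[abs_def]
      by (intro DERIV_diff DERIV_cdivide u' slow_antiderivative x')
    moreover have "slow 0 (ln (x\<^sup>2)) / x \<ge> 0"
    proof -
      have "ln (x\<^sup>2) \<le> 0" using x' by (simp add: ln_realpow)
      then have "slow 0 (ln (x\<^sup>2)) \<ge> 0"
        unfolding slow_0 by (intro divide_nonneg_pos) (auto intro: add_pos_nonneg)
      then show ?thesis using x' by simp
    qed
    moreover have "Re (I x / c) \<ge> 1 / 2"
    proof -
      have "norm (I x / c - 1) = norm (I x - c) / norm c"
        using c by (simp add: field_simps flip: norm_divide)
      also have "\<dots> \<le> 1 / 2" using \<delta>(4)[of x] x x' c by (simp add: field_simps)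
      finally show ?thesis using abs_Re_le_cmod[of "I x / c - 1"] by simp
    qed
    then have "0 \<le> slow 0 (ln (x\<^sup>2)) / x * (Re (I x / c) - 1 / 2)"
      using \<open>slow 0 (ln (x\<^sup>2)) / x \<ge> 0\<close> by (intro mult_nonneg_nonneg) auto
    then have "0 \<le> slow 0 (ln (x\<^sup>2)) / x * Re (I x / c) - slow 0 (ln (x\<^sup>2)) / x / 2"
      by (simp only: right_diff_distrib mult_1_right times_divide_eq_right)
    ultimately show "\<exists>y. ((\<lambda>r. u r - H r / 2) has_real_derivative y) (at x) \<and> 0 \<le> y"
      by blast
  qed
  define K where "K = u \<delta> - H \<delta> / 2 + C / norm c"
  define M where "M = max (- ln \<delta>) (exp (8 * K))"
  define r where "r = exp (- M)"
  have r: "0 < r" "r \<le> \<delta>"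
  proof -
    have "r \<le> exp (ln \<delta>)" unfolding r_def M_def by simp
    then show "r \<le> \<delta>" using \<delta>(1) by simp
  qed (simp add: r_def)
  have "\<bar>u r\<bar> \<le> norm (\<i> * F r / c)" unfolding u_def by (rule abs_Re_le_cmod)
  also have "\<dots> \<le> C / norm c"
    using F_bound[of r] r \<delta>(2) by (simp add: norm_divide norm_mult divide_right_mono)
  finally have "- H r / 2 \<le> K" using mono[OF r] by (simp add: K_def)
  moreover have "ln (r\<^sup>2) = - 2 * M" by (simp add: r_def ln_realpow)
  ultimately have "ln (1 + 4 * M\<^sup>2) \<le> 8 * K" by (simp add: H_def power_mult_distrib)
  then have "1 + 4 * M\<^sup>2 \<le> exp (8 * K)"
    by (metis add_pos_nonneg exp_le_cancel_iff exp_ln zero_le_power2 zero_less_one mult_nonneg_nonneg zero_le_numeral)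
  also have "\<dots> \<le> M" by (simp add: M_def)
  finally have "1 + 4 * M\<^sup>2 \<le> M" .
  moreover have "0 \<le> (2 * M - 1 / 4)\<^sup>2" by simp
  ultimately show False by (simp add: power2_eq_square algebra_simps)
qed

end

lemma exists_block_involution:
  assumes "CARD('m::finite) = 2 * N" and "N > 0"
  obtains \<tau> :: "'m::finite \<Rightarrow> 'm" and S s where "\<And>i. \<tau> (\<tau> i) = i" "\<And>i. \<tau> i \<in> S \<longleftrightarrow> i \<notin> S" "s \<in> S"
proof -
  obtain S :: "'m set" where S: "card S = N"
    using obtain_subset_with_card_n[of N "UNIV :: 'm set"] assms(1) by auto
  have "card (- S) = N"
    using S assms(1) by (simp add: Compl_eq_Diff_UNIV card_Diff_subset)
  then obtain h where h: "bij_betw h S (- S)"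
    using finite_same_card_bij[of S "- S"] S by auto
  define \<tau> where "\<tau> i = (if i \<in> S then h i else inv_into S h i)" for i
  have hS: "h i \<notin> S" if "i \<in> S" for i using bij_betwE[OF h] that by auto
  have iS: "inv_into S h i \<in> S" if "i \<notin> S" for i
    using bij_betwE[OF bij_betw_inv_into[OF h]] that by auto
  obtain s where "s \<in> S" using S assms(2) by (metis card_gt_0_iff all_not_in_conv)
  show thesis
  proof (rule that)
    show "\<tau> (\<tau> i) = i" for i
      using h hS iS by (auto simp: \<tau>_def bij_betw_inv_into_left bij_betw_inv_into_right)
    show "\<tau> i \<in> S \<longleftrightarrow> i \<notin> S" for i using hS iS by (auto simp: \<tau>_def)
  qed fact
qed

theorem theorem2:
  fixes k :: nat
  assumes "k \<ge> 1"
    and "CARD('m::finite) = 2 * CARD('n::finite)"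
  shows "\<exists>J :: real^'m \<Rightarrow> real^'m^'m.
           almost_complex J \<and> Ck_structure k J \<and> integrable_acs J \<and>
           \<not> (\<exists>(U :: (real^'m) set) (w :: real^'m \<Rightarrow> complex^'n).
                 0 \<in> U \<and> coord_chart w U \<and> CkLip k w U \<and>
                 (\<forall>p\<in>U. \<forall>j. cx_apply (J p) (coord_dw w p j) = (\<chi> l. \<i> * (coord_dw w p j $ l))))"
proof -
  obtain \<tau> :: "'m \<Rightarrow> 'm" and S s where \<tau>: "\<And>i. \<tau> (\<tau> i) = i" "\<And>i. \<tau> i \<in> S \<longleftrightarrow> i \<notin> S" and s: "s \<in> S"
    using exists_block_involution[OF assms(2)] by auto
  have \<tau>_neq: "\<tau> i \<noteq> i" for i using \<tau>(2)[of i] by metis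
  define \<alpha> where "\<alpha> i = (if i \<in> S then i else \<tau> i)" for i
  define \<beta> where "\<beta> i = (if i \<in> S then \<tau> i else i)" for i
  have ml: "mono_log slow (\<alpha> i) (\<beta> i)" for i
    using \<tau>_neq by unfold_locales (auto intro: slow_deriv slow_lim simp: \<alpha>_def \<beta>_def dest: sym)
  define A where "A i = mono_log.term_fun slow (\<alpha> i) (\<beta> i) (k + 2) 0 0 0" for i
  interpret block_structure \<tau> S A
    by unfold_locales (use \<tau> in \<open>auto simp: A_def \<alpha>_def \<beta>_def\<close>)
  have "Ck_structure k J"
    by (intro Ck_structure_J) (auto intro: mono_log.Ck_term_fun[OF ml] simp: A_def)
  moreover have "integrable_acs J"
  proof -
    obtain k' where k': "k = Suc k'" using assms(1) by (cases k) auto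
    have "\<exists>u v. \<forall>p. (A i has_derivative (\<lambda>h. h $ i * u p + h $ \<tau> i * v p)) (at p)" for i
    proof -
      have deg: "k + 2 + 0 = Suc k' + 2 * Suc 0" using k' by simp
      have "\<exists>u v. \<forall>p. (A i has_derivative (\<lambda>h. h $ \<alpha> i * u p + h $ \<beta> i * v p)) (at p)"
        unfolding A_def by (intro exI allI, rule mono_log.has_derivative_term_fun[OF ml deg])
      then obtain u v where D: "\<And>p. (A i has_derivative (\<lambda>h. h $ \<alpha> i * u p + h $ \<beta> i * v p)) (at p)"
        by blast
      show ?thesis
      proof (cases "i \<in> S")
        case True
        then have "\<alpha> i = i" "\<beta> i = \<tau> i" by (auto simp: \<alpha>_def \<beta>_def)
        then show ?thesis using D by (intro exI[of _ u] exI[of _ v]) simp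
      next
        case False
        then have "\<alpha> i = \<tau> i" "\<beta> i = i" by (auto simp: \<alpha>_def \<beta>_def)
        then show ?thesis using D by (intro exI[of _ v] exI[of _ u]) (simp add: add.commute)
      qed
    qed
    then have "\<forall>i. \<exists>u v. \<forall>p. (A i has_derivative (\<lambda>h. h $ i * u p + h $ \<tau> i * v p)) (at p)"
      by blast
    from choice[OF this] obtain u
      where "\<forall>i. \<exists>v. \<forall>p. (A i has_derivative (\<lambda>h. h $ i * u i p + h $ \<tau> i * v p)) (at p)"
      by blast
    from choice[OF this] obtain v
      where "\<forall>i p. (A i has_derivative (\<lambda>h. h $ i * u i p + h $ \<tau> i * v i p)) (at p)"
      by blast
    then show ?thesis by (intro integrable_acs_J) blast
  qed
  moreover have False
    if U: "0 \<in> U" "coord_chart w U" "CkLip k w U"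
      and hol: "\<forall>p\<in>U. \<forall>j. cx_apply (J p) (coord_dw w p j) = (\<chi> l. \<i> * (coord_dw w p j $ l))"
    for U and w :: "real^'m \<Rightarrow> complex^'n"
  proof -
    let ?D = "\<lambda>p. frechet_derivative w (at p)"
    have chart: "open U" "\<And>p. p \<in> U \<Longrightarrow> w differentiable (at p)" "\<And>p. p \<in> U \<Longrightarrow> bij (?D p)"
      using U(2) by (auto simp: coord_chart_def)
    interpret polar_plane "axis s 1 :: real^'m" "axis (\<tau> s) 1"
      by unfold_locales (use \<tau>_neq in \<open>auto simp: axis_eq_axis\<close>)
    have "?D 0 (axis s 1) $ j = 0" for j
    proof -
      define f where "f p = w p $ j" for p
      have fD: "frechet_derivative f (at p) h = ?D p h $ j" if "p \<in> U" for p h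
      proof -
        have "(f has_derivative (\<lambda>h. ?D p h $ j)) (at p)"
          unfolding f_def using chart(2)[OF that]
          by (intro bounded_linear.has_derivative[OF bounded_linear_vec_nth])
            (simp add: frechet_derivative_works)
        from frechet_derivative_at[OF this] show ?thesis by metis
      qed
      have "px f 0 = 0"
      proof (rule no_CkLip_solution)
        show "CkLip k f U" unfolding f_def by (rule CkLip_vec_nth[OF chart(1) U(3)])
        show "A s (polar r \<theta>) = (r * cos \<theta>) ^ (k + 2) * slow 0 (ln (r\<^sup>2)) / r\<^sup>2" for r \<theta>
        proof -
          have "(r * cos \<theta>)\<^sup>2 + (r * sin \<theta>)\<^sup>2 = r\<^sup>2"
            by (simp add: power_mult_distrib flip: distrib_left)
          moreover have "polar r \<theta> $ s = r * cos \<theta>" "polar r \<theta> $ \<tau> s = r * sin \<theta>"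
            using \<tau>_neq[of s] unfolding polar_def by (auto simp: axis_def)
          ultimately show ?thesis
            using s unfolding A_def mono_log.term_fun_def[OF ml] mono_log.sq_def[OF ml]
            by (simp add: \<alpha>_def \<beta>_def)
        qed
        show "py f p = (\<i> - of_real (A s p)) * px f p" if p: "p \<in> U" for p
        proof -
          have lin: "linear (?D p)" by (rule linear_frechet_derivative[OF chart(2)[OF p]])
          have "J p *v axis s 1 = A s p *\<^sub>R axis s 1 + axis (\<tau> s) 1"
            using s by (auto simp: vec_eq_iff J_nth axis_def \<tau>)
          then have "?D p (J p *v axis s 1) $ j = A s p *\<^sub>R (?D p (axis s 1) $ j) + ?D p (axis (\<tau> s) 1) $ j"
            using lin by (simp add: linear_add linear_scale)
          moreover have "?D p (J p *v axis s 1) $ j = \<i> * ?D p (axis s 1) $ j"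
            using hol p by (intro frechet_derivative_J_holomorphic chart) auto
          ultimately show ?thesis
            by (simp add: px_def py_def fD[OF p] scaleR_conv_of_real algebra_simps)
        qed
      qed (use assms(1) chart(1) U(1) in auto)
      then show ?thesis by (simp add: px_def fD[OF U(1)])
    qed
    then have "?D 0 (axis s 1) = ?D 0 0"
      using linear_0[OF linear_frechet_derivative[OF chart(2)[OF U(1)]]] by (simp add: vec_eq_iff)
    then have "(axis s 1 :: real^'m) = 0"
      using chart(3)[OF U(1)] by (meson bij_is_inj injD)
    then show False by (simp add: axis_eq_0_iff)
  qed
  ultimately show ?thesis using almost_complex_J by blast
qed

end
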